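(* Let $G$ be a profinite group. Then $\operatorname{Sub}(G)/G$ is scattered if and only if $\operatorname{Sub}(G)/G$ is countable.
   Context: $\operatorname{Sub}(G)$ is the space of closed subgroups of $G$, topologized so that $\operatorname{Sub}(G)\cong\lim_N\operatorname{Sub}(G/N)$ over open normal subgroups $N$ with each $\operatorname{Sub}(G/N)$ finite discrete; equivalently, a neighbourhood basis of $H$ is given by the sets $\{K\in\operatorname{Sub}(G)\mid NK=NH\}$ for $N$ open normal. $\operatorname{Sub}(G)/G$ is the quotient by the conjugation action of $G$, with the quotient topology. A topological space is scattered if every non-empty closed subset contains a point that is isolated in the subspace topology. Countable means finite or countably infinite. *)

theory Defs
  imports "HOL-Analysis.Analysis" "HOL-Algebra.Group_Action"
begin

section \<open>Profinite groups\<close>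

locale topological_group = group G for G (structure) +
  fixes T :: "'a topology"
  assumes topspace_eq_carrier: "topspace T = carrier G"
    and continuous_mult: "continuous_map (prod_topology T T) T (\<lambda>(x, y). x \<otimes> y)"
    and continuous_inv: "continuous_map T T (\<lambda>x. inv x)"

definition totally_disconnected_space :: "'a topology \<Rightarrow> bool" where
  "totally_disconnected_space X \<longleftrightarrow> (\<forall>S. connectedin X S \<longrightarrow> (\<exists>a. S \<subseteq> {a}))"

locale profinite_group = topological_group +
  assumes compact: "compact_space T"
    and Hausdorff: "Hausdorff_space T"
    and totally_disconnected: "totally_disconnected_space T"

section \<open>The space of closed subgroups\<close>

definition closed_subgroups :: "[_, 'a topology] \<Rightarrow> 'a set set" where
  "closed_subgroups G T = {H. subgroup H G \<and> closedin T H}"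

definition open_normal_subgroups :: "[_, 'a topology] \<Rightarrow> 'a set set" where
  "open_normal_subgroups G T = {N. N \<lhd> G \<and> openin T N}"

text \<open>
  The subgroups \<open>K\<close> that have the same image as \<open>H\<close> in the quotient by \<open>N\<close>.
\<close>

definition subgroup_nhd :: "[_, 'a topology, 'a set, 'a set] \<Rightarrow> 'a set set" where
  "subgroup_nhd G T N H = {K \<in> closed_subgroups G T. N <#>\<^bsub>G\<^esub> K = N <#>\<^bsub>G\<^esub> H}"

definition Sub_topology :: "[_, 'a topology] \<Rightarrow> 'a set topology" where
  "Sub_topology G T = topology (\<lambda>U. U \<subseteq> closed_subgroups G T \<and>
     (\<forall>H\<in>U. \<exists>N\<in>open_normal_subgroups G T. subgroup_nhd G T N H \<subseteq> U))"

context topological_group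
begin

lemma carrier_in_open_normal_subgroups: "carrier G \<in> open_normal_subgroups G T"
  using openin_topspace[of T] subgroup_self
  by (auto simp: open_normal_subgroups_def topspace_eq_carrier normal_inv_iff)

lemma Int_in_open_normal_subgroups:
  "\<lbrakk>M \<in> open_normal_subgroups G T; N \<in> open_normal_subgroups G T\<rbrakk>
    \<Longrightarrow> M \<inter> N \<in> open_normal_subgroups G T"
  by (auto simp: open_normal_subgroups_def normal_subgroup_intersect)

lemma subgroup_nhd_mono:
  assumes "M \<lhd> G" "N \<lhd> G" "M \<subseteq> N" and H: "H \<in> closed_subgroups G T"
  shows "subgroup_nhd G T M H \<subseteq> subgroup_nhd G T N H"
proof
  fix K assume K: "K \<in> subgroup_nhd G T M H"
  have sub: "subgroup M G" "subgroup N G"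
    using assms normal_imp_subgroup by auto
  have NM: "N <#> M = N"
  proof
    show "N <#> M \<subseteq> N"
      using assms(3) sub by (auto simp: set_mult_def subgroup.m_closed subset_iff)
    show "N \<subseteq> N <#> M"
    proof
      fix x assume "x \<in> N"
      then have "x = x \<otimes> \<one>" using sub(2) by (simp add: subgroup.mem_carrier)
      then show "x \<in> N <#> M"
        using \<open>x \<in> N\<close> subgroup.one_closed[OF sub(1)] unfolding set_mult_def by blast
    qed
  qed
  have eq: "N <#> L = N <#> (M <#> L)" if "L \<subseteq> carrier G" for L
    using set_mult_assoc[of N M L] that sub NM by (simp add: subgroup.subset)
  have "K \<subseteq> carrier G" "H \<subseteq> carrier G"
    using K H by (auto simp: subgroup_nhd_def closed_subgroups_def dest: subgroup.subset)
  then have "N <#> K = N <#> H"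
    using K eq by (simp add: subgroup_nhd_def)
  then show "K \<in> subgroup_nhd G T N H"
    using K by (simp add: subgroup_nhd_def)
qed

lemma istopology_Sub:
  "istopology (\<lambda>U. U \<subseteq> closed_subgroups G T \<and>
     (\<forall>H\<in>U. \<exists>N\<in>open_normal_subgroups G T. subgroup_nhd G T N H \<subseteq> U))"
  unfolding istopology_def
proof (intro conjI allI impI, goal_cases)
  case (1 U V)
  then show ?case by blast
next
  case (2 U V)
  show ?case
  proof
    fix H assume H: "H \<in> U \<inter> V"
    then obtain M N where MN: "M \<in> open_normal_subgroups G T" "subgroup_nhd G T M H \<subseteq> U"
      "N \<in> open_normal_subgroups G T" "subgroup_nhd G T N H \<subseteq> V"
      using 2 by blast
    have "H \<in> closed_subgroups G T" using H 2 by blast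
    then have "subgroup_nhd G T (M \<inter> N) H \<subseteq> subgroup_nhd G T M H"
      "subgroup_nhd G T (M \<inter> N) H \<subseteq> subgroup_nhd G T N H"
      using MN(1,3) Int_in_open_normal_subgroups[OF MN(1,3)]
      by (simp_all add: open_normal_subgroups_def subgroup_nhd_mono)
    then show "\<exists>N\<in>open_normal_subgroups G T. subgroup_nhd G T N H \<subseteq> U \<inter> V"
      using MN Int_in_open_normal_subgroups[OF MN(1,3)] by blast
  qed
next
  case (3 \<K>)
  then show ?case by blast
next
  case (4 \<K>)
  show ?case
  proof
    fix H assume "H \<in> \<Union>\<K>"
    then obtain U where "U \<in> \<K>" "H \<in> U" by blast
    with 4 obtain N where "N \<in> open_normal_subgroups G T" "subgroup_nhd G T N H \<subseteq> U"
      by blast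
    with \<open>U \<in> \<K>\<close> show "\<exists>N\<in>open_normal_subgroups G T. subgroup_nhd G T N H \<subseteq> \<Union>\<K>"
      by blast
  qed
qed

lemma openin_Sub_topology:
  "openin (Sub_topology G T) U \<longleftrightarrow> U \<subseteq> closed_subgroups G T \<and>
     (\<forall>H\<in>U. \<exists>N\<in>open_normal_subgroups G T. subgroup_nhd G T N H \<subseteq> U)"
  unfolding Sub_topology_def topology_inverse'[OF istopology_Sub] ..

lemma openin_subgroup_nhd:
  "N \<in> open_normal_subgroups G T \<Longrightarrow> openin (Sub_topology G T) (subgroup_nhd G T N H)"
  unfolding openin_Sub_topology by (auto simp: subgroup_nhd_def)

lemma topspace_Sub_topology: "topspace (Sub_topology G T) = closed_subgroups G T"
proof
  show "topspace (Sub_topology G T) \<subseteq> closed_subgroups G T"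
    using openin_topspace[of "Sub_topology G T"] unfolding openin_Sub_topology by blast
  have "openin (Sub_topology G T) (closed_subgroups G T)"
    unfolding openin_Sub_topology
    using carrier_in_open_normal_subgroups by (auto simp: subgroup_nhd_def)
  then show "closed_subgroups G T \<subseteq> topspace (Sub_topology G T)"
    by (rule openin_subset)
qed

end

section \<open>The quotient by conjugation\<close>

definition quotient_topology :: "'a topology \<Rightarrow> ('a \<Rightarrow> 'b) \<Rightarrow> 'b topology" where
  "quotient_topology X p =
     topology (\<lambda>V. V \<subseteq> p ` topspace X \<and> openin X {x \<in> topspace X. p x \<in> V})"

lemma openin_quotient_topology:
  "openin (quotient_topology X p) V \<longleftrightarrow>
     V \<subseteq> p ` topspace X \<and> openin X {x \<in> topspace X. p x \<in> V}"
proof -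
  have "istopology (\<lambda>V. V \<subseteq> p ` topspace X \<and> openin X {x \<in> topspace X. p x \<in> V})"
    unfolding istopology_def
  proof (intro conjI allI impI, goal_cases)
    case (2 U V)
    have "{x \<in> topspace X. p x \<in> U \<inter> V} =
        {x \<in> topspace X. p x \<in> U} \<inter> {x \<in> topspace X. p x \<in> V}" by blast
    with 2 show ?case by (simp add: openin_Int)
  next
    case (4 \<K>)
    have "{x \<in> topspace X. p x \<in> \<Union>\<K>} = (\<Union>V\<in>\<K>. {x \<in> topspace X. p x \<in> V})" by blast
    with 4 show ?case by auto
  qed blast+
  then show ?thesis
    unfolding quotient_topology_def by (simp add: topology_inverse')
qed

lemma topspace_quotient_topology: "topspace (quotient_topology X p) = p ` topspace X"
proof -
  have "{x \<in> topspace X. p x \<in> p ` topspace X} = topspace X" by blast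
  then have "openin (quotient_topology X p) (p ` topspace X)"
    by (simp add: openin_quotient_topology)
  then show ?thesis
    by (meson openin_quotient_topology openin_subset openin_topspace subset_antisym)
qed

lemma quotient_map_quotient_topology: "quotient_map X (quotient_topology X p) p"
  by (auto simp: quotient_map_def topspace_quotient_topology openin_quotient_topology)

definition conjugation :: "[_, 'a topology] \<Rightarrow> 'a \<Rightarrow> 'a set \<Rightarrow> 'a set" where
  "conjugation G T = (\<lambda>g. \<lambda>H\<in>closed_subgroups G T. g <#\<^bsub>G\<^esub> H #>\<^bsub>G\<^esub> inv\<^bsub>G\<^esub> g)"

lemma (in topological_group) closedin_conj:
  assumes g: "g \<in> carrier G" and H: "subgroup H G" "closedin T H"
  shows "closedin T (g <# H #> inv g)"
proof -
  have "continuous_map T (prod_topology T T) (\<lambda>x. (inv g, x))"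
    using g by (simp add: continuous_map_pairwise o_def topspace_eq_carrier)
  from continuous_map_compose[OF this continuous_mult]
  have l: "continuous_map T T (\<lambda>x. inv g \<otimes> x)" by (simp add: o_def)
  then have "continuous_map T (prod_topology T T) (\<lambda>x. (inv g \<otimes> x, g))"
    using g by (simp add: continuous_map_pairwise o_def topspace_eq_carrier)
  from continuous_map_compose[OF this continuous_mult]
  have "continuous_map T T (\<lambda>x. inv g \<otimes> x \<otimes> g)" by (simp add: o_def)
  from closedin_continuous_map_preimage[OF this H(2)]
  have "closedin T {x \<in> carrier G. inv g \<otimes> x \<otimes> g \<in> H}" by (simp add: topspace_eq_carrier)
  moreover have "g <# H #> inv g = {x \<in> carrier G. inv g \<otimes> x \<otimes> g \<in> H}"
  proof (intro Set.set_eqI iffI)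
    fix x assume "x \<in> g <# H #> inv g"
    then obtain h where h: "h \<in> H" "x = g \<otimes> h \<otimes> inv g"
      by (auto simp: l_coset_def r_coset_def)
    then have hc: "h \<in> carrier G" using H(1) by (simp add: subgroup.mem_carrier)
    then have "inv g \<otimes> x \<otimes> g = h" using g h(2) by (simp add: m_assoc inv_solve_left')
    then show "x \<in> {x \<in> carrier G. inv g \<otimes> x \<otimes> g \<in> H}" using g h hc by simp
  next
    fix x assume "x \<in> {x \<in> carrier G. inv g \<otimes> x \<otimes> g \<in> H}"
    then have x: "x \<in> carrier G" "inv g \<otimes> x \<otimes> g \<in> H" by auto
    have "g \<otimes> (inv g \<otimes> x \<otimes> g) \<otimes> inv g = x"
      using g x(1) by (simp add: m_assoc) (simp add: m_assoc[symmetric])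
    then show "x \<in> g <# H #> inv g"
      using x(2) unfolding l_coset_def r_coset_def by force
  qed
  ultimately show ?thesis by simp
qed

lemma (in topological_group) group_action_conjugation:
  "group_action G (closed_subgroups G T) (conjugation G T)"
proof -
  let ?E = "closed_subgroups G T" and ?c = "\<lambda>g H. g <# H #> inv g"
  have closed: "?c g H \<in> ?E" if "g \<in> carrier G" "H \<in> ?E" for g H
    using that closedin_conj subgroup_conjugation_is_surj2 by (simp add: closed_subgroups_def)
  have sub: "H \<subseteq> carrier G" if "H \<in> ?E" for H
    using that by (simp add: closed_subgroups_def subgroup.subset)
  have comp: "?c (g \<otimes> h) H = ?c g (?c h H)" if "g \<in> carrier G" "h \<in> carrier G" "H \<in> ?E" for g h H
    using that sub[OF that(3)]
    by (simp add: inv_mult_group coset_mult_assoc[symmetric] coset_assoc l_coset_subset_G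
        lcos_m_assoc r_coset_subset_G)
  have one: "?c \<one> H = H" if "H \<in> ?E" for H
    using sub[OF that] by (simp add: lcos_mult_one coset_mult_one)
  have inv1: "?c (inv g) (?c g H) = H" if "g \<in> carrier G" "H \<in> ?E" for g H
    using comp[of "inv g" g H] one that by simp
  have inv2: "?c g (?c (inv g) H) = H" if "g \<in> carrier G" "H \<in> ?E" for g H
    using comp[of g "inv g" H] one that by simp
  have bij: "bij_betw (?c g) ?E ?E" if g: "g \<in> carrier G" for g
    by (rule bij_betw_byWitness[where f' = "?c (inv g)"])
      (use g closed[OF g] closed[OF inv_closed[OF g]] inv1 inv2 in \<open>auto simp del: inv_inv\<close>)
  have Bij: "conjugation G T g \<in> Bij ?E" if "g \<in> carrier G" for g
    using bij[OF that] by (simp add: Bij_def conjugation_def)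
  have "conjugation G T \<in> hom G (BijGroup ?E)"
  proof (rule homI)
    show "conjugation G T g \<in> carrier (BijGroup ?E)" if "g \<in> carrier G" for g
      using Bij that by (simp add: BijGroup_def)
    show "conjugation G T (g \<otimes> h) = conjugation G T g \<otimes>\<^bsub>BijGroup ?E\<^esub> conjugation G T h"
      if "g \<in> carrier G" "h \<in> carrier G" for g h
      using that Bij comp closed
      by (auto simp: BijGroup_def conjugation_def compose_def fun_eq_iff)
  qed
  then show ?thesis
    by (simp add: group_action_def group_hom_def group_hom_axioms_def group_BijGroup is_group)
qed

definition Sub_mod_conj :: "[_, 'a topology] \<Rightarrow> 'a set set topology" where
  "Sub_mod_conj G T = quotient_topology (Sub_topology G T) (orbit G (conjugation G T))"

lemma (in topological_group) topspace_Sub_mod_conj: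
  "topspace (Sub_mod_conj G T) = orbits G (closed_subgroups G T) (conjugation G T)"
  by (auto simp: Sub_mod_conj_def topspace_quotient_topology topspace_Sub_topology orbits_def)

section \<open>Scattered spaces\<close>

definition scattered_space :: "'a topology \<Rightarrow> bool" where
  "scattered_space X \<longleftrightarrow>
     (\<forall>C. closedin X C \<and> C \<noteq> {} \<longrightarrow> (\<exists>x\<in>C. openin (subtopology X C) {x}))"

end

theory Submission
  imports Defs "HOL-Algebra.Zassenhaus"
begin

text \<open>
  The space \<open>Sub(G)/G\<close> is compact Hausdorff, so if it is countable then the Baire category theorem,
  applied to its closed subspaces, makes it scattered. Conversely, an isolated point of
  \<open>Sub(G)/G\<close> yields an open normal subgroup \<open>N\<close> such that no proper open subgroup \<open>M\<close> satisfies
  \<open>N M = G\<close>. A finite transversal of \<open>N\<close> then generates \<open>G\<close> topologically, hence \<open>G\<close> has only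
  countably many open normal subgroups and \<open>Sub(G)/G\<close> is second countable. A scattered second
  countable space is countable by the Cantor-Bendixson argument.
\<close>

section \<open>Scattered and countable spaces\<close>

text \<open>\<open>G\<close> is not assumed metrizable, so \<open>Sub(G)\<close> need not have a
  countable base; countability of the base has to be forced by one isolated point of the whole
  space. The condition on \<open>N\<close> says that \<open>N\<close> lies in every maximal open
  subgroup, hence in the Frattini subgroup: a maximal open subgroup not containing the normal
  subgroup \<open>N\<close> would have product \<open>G\<close> with it. A set \<open>S\<close>
  meeting every coset of \<open>N\<close> generates topologically because every open subgroup
  containing \<open>S\<close> has product \<open>G\<close> with \<open>N\<close>. In the converse
  direction the delicate point is that the quotient is Hausdorff: this needs closed orbits, hence
  compactness of \<open>G\<close>, and the fact that conjugation respects neighbourhoods for one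
  fixed \<open>N\<close>.\<close>

lemma scattered_imp_countable:
  assumes "second_countable X" "scattered_space X"
  shows "countable (topspace X)"
proof -
  obtain \<B> where \<B>: "countable \<B>" "\<And>V. V \<in> \<B> \<Longrightarrow> openin X V"
    and base: "\<And>U x. openin X U \<Longrightarrow> x \<in> U \<Longrightarrow> \<exists>V\<in>\<B>. x \<in> V \<and> V \<subseteq> U"
    using assms(1) unfolding second_countable_def by metis
  \<comment> \<open>\<open>W\<close> is the largest countable open set. An isolated point of its
    complement would have a basic neighbourhood with at most one point outside \<open>W\<close>;
    that neighbourhood is countable and hence already part of \<open>W\<close>.\<close>
  define W where "W = (\<Union>V\<in>{V \<in> \<B>. countable V}. V)"
  have "countable {V \<in> \<B>. countable V}"
    using \<B>(1) by (rule countable_subset[rotated]) blast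
  then have W: "countable W"
    unfolding W_def by (rule countable_UN) blast
  have "openin X W"
    unfolding W_def by (rule openin_Union) (use \<B>(2) in blast)
  have "topspace X - W = {}"
  proof (rule ccontr)
    assume "topspace X - W \<noteq> {}"
    moreover have "closedin X (topspace X - W)"
      using \<open>openin X W\<close> by blast
    ultimately obtain x where x: "x \<in> topspace X - W"
      "openin (subtopology X (topspace X - W)) {x}"
      using assms(2) unfolding scattered_space_def by metis
    then obtain U where U: "openin X U" "{x} = U \<inter> (topspace X - W)"
      by (auto simp: openin_subtopology)
    then obtain V where V: "V \<in> \<B>" "x \<in> V" "V \<subseteq> U"
      using base by blast
    have "V \<subseteq> insert x W"
      using U V openin_subset[OF U(1)] by blast
    then have "countable V"
      using W by (meson countable_insert countable_subset)
    then show False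
      using V x(1) by (auto simp: W_def)
  qed
  then show ?thesis
    using W by (meson Diff_eq_empty_iff countable_subset)
qed

lemma compact_Hausdorff_countable_imp_scattered:
  assumes "compact_space X" "Hausdorff_space X" "countable (topspace X)"
  shows "scattered_space X"
  unfolding scattered_space_def
proof (intro allI impI, elim conjE)
  fix C assume C: "closedin X C" "C \<noteq> {}"
  let ?Y = "subtopology X C"
  have top: "topspace ?Y = C"
    by (rule topspace_subtopology_subset[OF closedin_subset[OF C(1)]])
  have Y: "compact_space ?Y" "Hausdorff_space ?Y"
    using compact_space_subtopology[OF closedin_compact_space[OF assms(1) C(1)]]
      Hausdorff_space_subtopology[OF assms(2)] by simp_all
  show "\<exists>x\<in>C. openin ?Y {x}"
  proof (rule ccontr)
    assume contra: "\<not> (\<exists>x\<in>C. openin ?Y {x})"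
    \<comment> \<open>\<open>C\<close> is the countable union of its singletons, which are closed
      and, without isolated points, have empty interior; Baire then gives \<open>C\<close> empty
      interior in itself.\<close>
    have "?Y interior_of (\<Union>x\<in>C. {x}) = {}"
    proof (rule Baire_category_alt)
      show "completely_metrizable_space ?Y \<or> locally_compact_space ?Y \<and> regular_space ?Y"
        using Y by (simp add: compact_Hausdorff_imp_regular_space compact_imp_locally_compact_space)
      show "countable ((\<lambda>x. {x}) ` C)"
        using countable_subset[OF closedin_subset[OF C(1)] assms(3)] by (rule countable_image)
      fix S assume "S \<in> (\<lambda>x. {x}) ` C"
      then obtain x where x: "x \<in> C" "S = {x}" by blast
      have "?Y interior_of {x} \<noteq> {x}"
        using contra x(1) by (metis openin_interior_of)
      then show "closedin ?Y S \<and> ?Y interior_of S = {}"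
        using x(1) top closedin_Hausdorff_sing_eq[OF Y(2)] interior_of_subset[of ?Y "{x}"]
        unfolding x(2) subset_singleton_iff by metis
    qed
    then show False
      using top C(2) interior_of_topspace[of ?Y] by (metis UN_singleton)
  qed
qed

text \<open>Directedness puts some \<open>C k\<close> below every finite intersection, so nonempty
  members already give the finite intersection property.\<close>

lemma compact_directed_Inter_nonempty:
  assumes "compact_space X" "I \<noteq> {}" "\<And>i. i \<in> I \<Longrightarrow> closedin X (C i)"
    and nonempty: "\<And>i. i \<in> I \<Longrightarrow> C i \<noteq> {}"
    and directed: "\<And>i j. i \<in> I \<Longrightarrow> j \<in> I \<Longrightarrow> \<exists>k\<in>I. C k \<subseteq> C i \<inter> C j"
  shows "\<Inter>(C ` I) \<noteq> {}"
proof -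
  have lower: "\<exists>k\<in>I. C k \<subseteq> \<Inter>(C ` F)" if "finite F" "F \<subseteq> I" for F
    using that
  proof (induction F)
    case empty
    then show ?case using assms(2) by auto
  next
    case (insert i F)
    then obtain k where "k \<in> I" "C k \<subseteq> \<Inter>(C ` F)" by auto
    moreover obtain l where "l \<in> I" "C l \<subseteq> C i \<inter> C k"
      using directed insert.prems \<open>k \<in> I\<close> by blast
    ultimately show ?case by auto
  qed
  have "\<Inter>\<F> \<noteq> {}" if "finite \<F>" "\<F> \<subseteq> C ` I" for \<F>
    using that lower nonempty by (metis finite_subset_image subset_empty)
  then show ?thesis
    using assms(1,3) by (auto simp: compact_space_fip)
qed

section \<open>Topological groups\<close>

context topological_group
begin

lemma continuous_map_mult:
  assumes "continuous_map X T f" "continuous_map X T g"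
  shows "continuous_map X T (\<lambda>x. f x \<otimes> g x)"
proof -
  have "continuous_map X (prod_topology T T) (\<lambda>x. (f x, g x))"
    using assms by (simp add: continuous_map_pairwise o_def)
  from continuous_map_compose[OF this continuous_mult] show ?thesis
    by (simp add: o_def)
qed

lemma continuous_map_right_translation:
  assumes "a \<in> carrier G"
  shows "continuous_map T T (\<lambda>x. x \<otimes> a)"
  using assms by (auto intro!: continuous_map_mult simp: topspace_eq_carrier)

lemma openin_r_coset:
  assumes "openin T U" "a \<in> carrier G"
  shows "openin T (U #> a)"
proof -
  have "U \<subseteq> carrier G"
    using assms(1) openin_subset topspace_eq_carrier by blast
  then have "U #> a = {x \<in> topspace T. x \<otimes> inv a \<in> U}"
    using assms(2) by (force simp: r_coset_def topspace_eq_carrier m_assoc subset_iff)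
  then show ?thesis
    using openin_continuous_map_preimage[OF continuous_map_right_translation assms(1)] assms(2)
    by simp
qed

lemma openin_set_mult:
  assumes "openin T U" "L \<subseteq> carrier G"
  shows "openin T (U <#> L)"
proof -
  have "U <#> L = (\<Union>a\<in>L. U #> a)"
    by (auto simp: set_mult_def r_coset_def)
  moreover have "openin T (\<Union>a\<in>L. U #> a)"
    by (rule openin_Union) (use assms openin_r_coset in \<open>auto simp: subset_iff\<close>)
  ultimately show ?thesis by simp
qed

text \<open>Since \<open>N\<close> is closed under inverses, \<open>x = n \<otimes> l\<close> can be
  solved for \<open>l\<close>. Membership in \<open>N <#> L\<close> thus becomes a meeting of the
  coset \<open>N #> x\<close> with \<open>L\<close>, the form in which it is used below.\<close>

lemma mem_set_mult_subgroup_iff: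
  assumes "subgroup N G" "L \<subseteq> carrier G" "x \<in> carrier G"
  shows "x \<in> N <#> L \<longleftrightarrow> (\<exists>n\<in>N. n \<otimes> x \<in> L)"
proof
  assume "x \<in> N <#> L"
  then obtain n l where nl: "n \<in> N" "l \<in> L" "x = n \<otimes> l"
    by (auto simp: set_mult_def)
  then have "inv n \<otimes> x = l"
    using assms subgroup.mem_carrier[OF assms(1)] by (auto simp: m_assoc[symmetric])
  then show "\<exists>n\<in>N. n \<otimes> x \<in> L"
    using nl subgroup.m_inv_closed[OF assms(1)] by metis
next
  assume "\<exists>n\<in>N. n \<otimes> x \<in> L"
  then obtain n where n: "n \<in> N" "n \<otimes> x \<in> L" by blast
  then have "x = inv n \<otimes> (n \<otimes> x)"
    using assms subgroup.mem_carrier[OF assms(1)] by (simp add: m_assoc[symmetric])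
  then show "x \<in> N <#> L"
    using n subgroup.m_inv_closed[OF assms(1)] unfolding set_mult_def by blast
qed

text \<open>The complement of \<open>N <#> L\<close> is again a union of right cosets of
  \<open>N\<close>, hence open.\<close>

lemma closedin_set_mult:
  assumes N: "subgroup N G" "openin T N" and L: "L \<subseteq> carrier G"
  shows "closedin T (N <#> L)"
proof -
  let ?R = "carrier G - (N <#> L)"
  have "N <#> ?R \<subseteq> ?R"
  proof
    fix x assume "x \<in> N <#> ?R"
    then obtain n y where ny: "n \<in> N" "y \<in> carrier G" "y \<notin> N <#> L" "x = n \<otimes> y"
      by (auto simp: set_mult_def)
    then have x: "x \<in> carrier G"
      using subgroup.mem_carrier[OF N(1)] by auto
    have "x \<notin> N <#> L"
    proof
      assume "x \<in> N <#> L"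
      then obtain m where m: "m \<in> N" "m \<otimes> x \<in> L"
        using mem_set_mult_subgroup_iff[OF N(1) L x] by blast
      then have "(m \<otimes> n) \<otimes> y \<in> L"
        using ny subgroup.mem_carrier[OF N(1)] by (simp add: m_assoc)
      then show False
        using ny m mem_set_mult_subgroup_iff[OF N(1) L ny(2)] subgroup.m_closed[OF N(1)] by blast
    qed
    then show "x \<in> ?R" using x by blast
  qed
  moreover have "?R \<subseteq> N <#> ?R"
    using subgroup.one_closed[OF N(1)] by (force simp: set_mult_def)
  ultimately have "openin T ?R"
    using openin_set_mult[OF N(2), of ?R] by auto
  moreover have "N <#> L \<subseteq> carrier G"
    using L N(1) by (simp add: setmult_subset_G subgroup.subset)
  ultimately show ?thesis
    by (simp add: closedin_def topspace_eq_carrier)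
qed

lemma open_subgroup_imp_closed:
  assumes "subgroup M G" "openin T M"
  shows "M \<in> closed_subgroups G T"
proof -
  have "M <#> {\<one>} = M"
    using assms(1) coset_mult_one[of M] by (simp add: r_coset_eq_set_mult[symmetric] subgroup.subset)
  then show ?thesis
    using assms closedin_set_mult[OF assms, of "{\<one>}"] by (simp add: closed_subgroups_def)
qed

lemma subset_set_mult:
  assumes "subgroup N G" "subgroup K G"
  shows "N \<subseteq> N <#> K" "K \<subseteq> N <#> K"
proof -
  show "N \<subseteq> N <#> K"
  proof
    fix x assume "x \<in> N"
    moreover have "x = x \<otimes> \<one>"
      using \<open>x \<in> N\<close> subgroup.mem_carrier[OF assms(1)] by simp
    ultimately show "x \<in> N <#> K"
      using subgroup.one_closed[OF assms(2)] unfolding set_mult_def by blast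
  qed
  show "K \<subseteq> N <#> K"
  proof
    fix x assume "x \<in> K"
    moreover have "x = \<one> \<otimes> x"
      using \<open>x \<in> K\<close> subgroup.mem_carrier[OF assms(2)] by simp
    ultimately show "x \<in> N <#> K"
      using subgroup.one_closed[OF assms(1)] unfolding set_mult_def by blast
  qed
qed

lemma set_mult_absorb:
  assumes "subgroup K G" "N \<subseteq> K" "\<one> \<in> N"
  shows "N <#> K = K"
proof
  show "N <#> K \<subseteq> K"
    using assms by (auto simp: set_mult_def subgroup.m_closed subset_iff)
  show "K \<subseteq> N <#> K"
    using assms(3) subgroup.mem_carrier[OF assms(1)] by (force simp: set_mult_def)
qed

lemma openin_subgroup_superset:
  assumes "subgroup K G" "subgroup N G" "openin T N" "N \<subseteq> K"
  shows "openin T K"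
  using openin_set_mult[OF assms(3) subgroup.subset[OF assms(1)]]
    set_mult_absorb[OF assms(1,4) subgroup.one_closed[OF assms(2)]] by simp

lemma open_normal_subgroupD:
  assumes "N \<in> open_normal_subgroups G T"
  shows "N \<lhd> G" "subgroup N G" "openin T N"
  using assms by (auto simp: open_normal_subgroups_def normal_imp_subgroup)

lemma closed_subgroupD:
  assumes "H \<in> closed_subgroups G T"
  shows "subgroup H G" "closedin T H" "H \<subseteq> carrier G"
  using assms by (auto simp: closed_subgroups_def dest: subgroup.subset)

text \<open>For closed \<open>H\<close>, these facts make \<open>N <#> H\<close> an open subgroup
  inside the basic neighbourhood of \<open>H\<close> given by \<open>N\<close>, so closed subgroups
  can be approximated by open ones.\<close>

lemma set_mult_closed_subgroup:
  assumes N: "N \<in> open_normal_subgroups G T" and H: "subgroup H G"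
  shows "subgroup (N <#> H) G" "openin T (N <#> H)" "N <#> H \<in> closed_subgroups G T"
    "N <#> (N <#> H) = N <#> H"
proof -
  note N' = open_normal_subgroupD[OF N]
  show sub: "subgroup (N <#> H) G"
    using mult_norm_subgroup N'(1) H by blast
  show op: "openin T (N <#> H)"
    using openin_set_mult N'(3) subgroup.subset[OF H] by blast
  show "N <#> H \<in> closed_subgroups G T"
    using open_subgroup_imp_closed sub op by blast
  show "N <#> (N <#> H) = N <#> H"
    using set_mult_absorb sub subset_set_mult(1)[OF N'(2) H] subgroup.one_closed[OF N'(2)] by blast
qed

end

section \<open>Open normal subgroups of profinite groups\<close>

context profinite_group
begin

text \<open>
  A clopen set \<open>V\<close> contains its syntactic congruence class of the unit: the elements that can be
  deleted from any product \<open>x g y\<close> without changing membership in \<open>V\<close>. Compactness makes it open.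
\<close>

lemma clopen_contains_open_normal_subgroup:
  assumes V: "openin T V" "closedin T V" "\<one> \<in> V"
  obtains N where "N \<in> open_normal_subgroups G T" "N \<subseteq> V"
proof -
  define N where
    "N = {g \<in> carrier G. \<forall>x\<in>carrier G. \<forall>y\<in>carrier G. x \<otimes> y \<in> V \<longleftrightarrow> x \<otimes> g \<otimes> y \<in> V}"
  have N: "g \<in> carrier G" "x \<otimes> y \<in> V \<longleftrightarrow> x \<otimes> g \<otimes> y \<in> V"
    if "g \<in> N" "x \<in> carrier G" "y \<in> carrier G" for g x y
    using that by (auto simp: N_def)
  have sub: "subgroup N G"
  proof (rule subgroupI)
    show "N \<subseteq> carrier G" by (auto simp: N_def)
    show "N \<noteq> {}" by (auto simp: N_def intro!: exI[of _ \<one>])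
    fix g assume g: "g \<in> N"
    have gc: "g \<in> carrier G" using g by (simp add: N_def)
    have "x \<otimes> inv g \<otimes> g \<otimes> y = x \<otimes> y" if "x \<in> carrier G" "y \<in> carrier G" for x y
      using that gc by (simp add: m_assoc)
    then have "x \<otimes> y \<in> V \<longleftrightarrow> x \<otimes> inv g \<otimes> y \<in> V" if "x \<in> carrier G" "y \<in> carrier G" for x y
      using N(2)[OF g, of "x \<otimes> inv g" y] that gc by simp
    then show "inv g \<in> N" using gc by (simp add: N_def)
    fix h assume h: "h \<in> N"
    have hc: "h \<in> carrier G" using h by (simp add: N_def)
    have "x \<otimes> g \<otimes> h \<otimes> y = x \<otimes> (g \<otimes> h) \<otimes> y" if "x \<in> carrier G" "y \<in> carrier G" for x y
      using that gc hc by (simp add: m_assoc)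
    then have "x \<otimes> y \<in> V \<longleftrightarrow> x \<otimes> (g \<otimes> h) \<otimes> y \<in> V" if "x \<in> carrier G" "y \<in> carrier G" for x y
      using N(2)[OF g, of x y] N(2)[OF h, of "x \<otimes> g" y] that gc hc by simp
    then show "g \<otimes> h \<in> N" using gc hc by (simp add: N_def)
  qed
  moreover have "a \<otimes> g \<otimes> inv a \<in> N" if a: "a \<in> carrier G" and g: "g \<in> N" for a g
  proof -
    have gc: "g \<in> carrier G" using g by (simp add: N_def)
    have "x \<otimes> y \<in> V \<longleftrightarrow> x \<otimes> (a \<otimes> g \<otimes> inv a) \<otimes> y \<in> V"
      if xy: "x \<in> carrier G" "y \<in> carrier G" for x y
    proof -
      have "a \<otimes> (inv a \<otimes> y) = y"
        using a xy by (simp add: m_assoc[symmetric])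
      then have "x \<otimes> a \<otimes> (inv a \<otimes> y) = x \<otimes> y"
        "x \<otimes> a \<otimes> g \<otimes> (inv a \<otimes> y) = x \<otimes> (a \<otimes> g \<otimes> inv a) \<otimes> y"
        using a gc xy by (simp_all add: m_assoc)
      then show ?thesis
        using N(2)[OF g, of "x \<otimes> a" "inv a \<otimes> y"] a xy by simp
    qed
    then show ?thesis using a gc by (simp add: N_def)
  qed
  ultimately have normal: "N \<lhd> G"
    by (simp add: normal_inv_iff)
  let ?Q = "prod_topology T T" and ?P = "prod_topology T (prod_topology T T)"
  let ?f = "\<lambda>z. fst (snd z) \<otimes> snd (snd z)" and ?g = "\<lambda>z. fst (snd z) \<otimes> fst z \<otimes> snd (snd z)"
  have proj: "continuous_map ?P T fst" "continuous_map ?P T (\<lambda>z. fst (snd z))"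
    "continuous_map ?P T (\<lambda>z. snd (snd z))"
    using continuous_map_compose[OF continuous_map_snd[of T ?Q] continuous_map_fst]
      continuous_map_compose[OF continuous_map_snd[of T ?Q] continuous_map_snd]
    by (simp_all add: continuous_map_fst o_def)
  have f: "continuous_map ?P T ?f" and g: "continuous_map ?P T ?g"
    by (intro continuous_map_mult proj)+
  \<comment> \<open>\<open>D\<close> consists of the triples \<open>(g, x, y)\<close> where deleting
    \<open>g\<close> changes membership in \<open>V\<close>; it is closed because \<open>V\<close>
    is clopen. Projection along the compact factor \<open>?Q\<close> is a closed map, and
    \<open>N\<close> is the complement of the image of \<open>D\<close>.\<close>
  define D where "D = ({z \<in> topspace ?P. ?f z \<in> V} \<inter> {z \<in> topspace ?P. ?g z \<in> topspace T - V}) \<union>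
    ({z \<in> topspace ?P. ?f z \<in> topspace T - V} \<inter> {z \<in> topspace ?P. ?g z \<in> V})"
  have "closedin T (topspace T - V)"
    using V(1) by (rule openin_closedin_eq[THEN iffD1, THEN conjunct2])
  then have "closedin ?P D"
    unfolding D_def
    by (intro closedin_Un closedin_Int closedin_continuous_map_preimage[OF f]
        closedin_continuous_map_preimage[OF g] V(2))
  moreover have "compact_space ?Q"
    by (simp add: compact_space_prod_topology compact)
  ultimately have cl: "closedin T (fst ` D)"
    using closed_map_fst[of ?Q T] by (simp add: closed_map_def)
  have "topspace T - fst ` D = N"
  proof (intro Set.set_eqI iffI)
    fix g assume "g \<in> topspace T - fst ` D"
    then have gc: "g \<in> carrier G" and gD: "\<And>x y. (g, x, y) \<notin> D"
      by (auto simp: topspace_eq_carrier image_iff)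
    have "x \<otimes> y \<in> V \<longleftrightarrow> x \<otimes> g \<otimes> y \<in> V" if "x \<in> carrier G" "y \<in> carrier G" for x y
      using gD[of x y] gc that by (auto simp: D_def topspace_eq_carrier)
    then show "g \<in> N" using gc by (simp add: N_def)
  next
    fix g assume "g \<in> N"
    then have "g \<in> carrier G" and "(g, x, y) \<notin> D" for x y
      by (auto simp: D_def N_def topspace_eq_carrier)
    then show "g \<in> topspace T - fst ` D"
      by (auto simp: topspace_eq_carrier)
  qed
  then have "openin T N"
    using cl by (metis closedin_def)
  then have "N \<in> open_normal_subgroups G T"
    using normal by (simp add: open_normal_subgroups_def)
  moreover have "N \<subseteq> V"
  proof
    fix g assume "g \<in> N"
    then show "g \<in> V"
      using N(1)[of g \<one> \<one>] N(2)[of g \<one> \<one>] V(3) by simp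
  qed
  ultimately show thesis by (rule that)
qed

text \<open>In a compact Hausdorff space, clopen sets separate a component from any closed set
  disjoint from it. The component of \<open>\<one>\<close> is a singleton, so \<open>V\<close>
  contains a clopen neighbourhood of \<open>\<one>\<close>.\<close>

lemma nhd_contains_open_normal_subgroup:
  assumes V: "openin T V" "\<one> \<in> V"
  obtains N where "N \<in> open_normal_subgroups G T" "N \<subseteq> V"
proof -
  let ?C = "connected_component_of_set T \<one>"
  have one: "\<one> \<in> topspace T" by (simp add: topspace_eq_carrier)
  have "\<one> \<in> ?C"
    using connected_component_of_refl[of T \<one>] one by simp
  moreover obtain a where "?C \<subseteq> {a}"
    using totally_disconnected connectedin_connected_component_of[of T \<one>]
    unfolding totally_disconnected_space_def by metis
  ultimately have C: "?C = {\<one>}" by auto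
  have "separated_between T {\<one>} (topspace T - V)"
  proof (rule separated_between_compact_connected_component)
    show "locally_compact_space T" "Hausdorff_space T"
      using compact Hausdorff by (auto simp: compact_imp_locally_compact_space)
    show "{\<one>} \<in> connected_components_of T"
      unfolding connected_components_of_def using one by (auto simp: C[symmetric])
    show "closedin T (topspace T - V)"
      using V(1) by (rule openin_closedin_eq[THEN iffD1, THEN conjunct2])
  qed (use one V(2) in auto)
  then obtain U where U: "closedin T U" "openin T U" "\<one> \<in> U" "topspace T - V \<subseteq> topspace T - U"
    unfolding separated_between by auto
  then have "U \<subseteq> V"
    using openin_subset[OF U(2)] by auto
  moreover obtain N where "N \<in> open_normal_subgroups G T" "N \<subseteq> U"
    using clopen_contains_open_normal_subgroup[OF U(2,1,3)] by metis
  ultimately show thesis using that by auto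
qed

text \<open>Continuity of right translation by \<open>x\<close> at \<open>\<one>\<close> gives an
  \<open>N\<close> whose coset \<open>N #> x\<close> misses \<open>H\<close>.\<close>

lemma separate_from_closed_subgroup:
  assumes H: "closedin T H" and x: "x \<in> carrier G" "x \<notin> H"
  obtains N where "N \<in> open_normal_subgroups G T" "x \<notin> N <#> H"
proof -
  let ?V = "{y \<in> topspace T. y \<otimes> x \<in> topspace T - H}"
  have "openin T (topspace T - H)"
    using H by (simp add: closedin_def)
  then have "openin T ?V"
    by (rule openin_continuous_map_preimage[OF continuous_map_right_translation[OF x(1)]])
  moreover have "\<one> \<in> ?V"
    using x by (simp add: topspace_eq_carrier)
  ultimately obtain N where N: "N \<in> open_normal_subgroups G T" "N \<subseteq> ?V"
    using nhd_contains_open_normal_subgroup by metis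
  have "H \<subseteq> carrier G"
    using closedin_subset[OF H] by (simp add: topspace_eq_carrier)
  then have "x \<notin> N <#> H"
    using mem_set_mult_subgroup_iff[OF open_normal_subgroupD(2)[OF N(1)] _ x(1)] N(2) by auto
  with N(1) show thesis by (rule that)
qed

lemma Inter_set_mult_closed_subgroup:
  assumes "H \<in> closed_subgroups G T"
  shows "(\<Inter>N\<in>open_normal_subgroups G T. N <#> H) = H"
proof
  note H = closed_subgroupD[OF assms]
  show "H \<subseteq> (\<Inter>N\<in>open_normal_subgroups G T. N <#> H)"
    using subset_set_mult(2)[OF open_normal_subgroupD(2) H(1)] by (intro INT_greatest)
  show "(\<Inter>N\<in>open_normal_subgroups G T. N <#> H) \<subseteq> H"
  proof
    fix x assume x: "x \<in> (\<Inter>N\<in>open_normal_subgroups G T. N <#> H)"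
    then have "x \<in> carrier G"
      using setmult_subset_G[OF subset_refl H(3)] carrier_in_open_normal_subgroups by auto
    then show "x \<in> H"
      using x separate_from_closed_subgroup[OF H(2), of x] by (metis INT_D)
  qed
qed

section \<open>Finiteness modulo an open subgroup\<close>

lemma finite_transversal:
  assumes N: "subgroup N G" "openin T N"
  obtains S where "finite S" "S \<subseteq> carrier G" "N <#> S = carrier G"
proof -
  have cover: "(\<Union>a\<in>carrier G. N #> a) = topspace T"
    using rcos_self[OF _ N(1)] r_coset_subset_G[OF subgroup.subset[OF N(1)]]
    by (auto simp: topspace_eq_carrier)
  have op: "\<forall>U\<in>(\<lambda>a. N #> a) ` carrier G. openin T U"
    using openin_r_coset[OF N(2)] by auto
  obtain \<F> where F: "finite \<F>" "\<F> \<subseteq> (\<lambda>a. N #> a) ` carrier G" "\<Union>\<F> = topspace T"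
    using compact[unfolded compact_space] op cover by metis
  then obtain S where S: "S \<subseteq> carrier G" "finite S" "\<F> = (\<lambda>a. N #> a) ` S"
    by (metis finite_subset_image)
  have "N <#> S = \<Union>\<F>"
    unfolding S(3) by (auto simp: set_mult_def r_coset_def)
  then show thesis
    using that S F(3) topspace_eq_carrier by metis
qed

text \<open>As a union of cosets of \<open>N\<close>, the set \<open>N <#> K\<close> is determined
  by its trace on a finite set \<open>S\<close> that meets every coset.\<close>

lemma finite_set_mult_image:
  assumes "subgroup N G" "openin T N"
  shows "finite ((\<lambda>K. N <#> K) ` Pow (carrier G))"
proof -
  obtain S where S: "finite S" "S \<subseteq> carrier G" "N <#> S = carrier G"
    using finite_transversal[OF assms] .
  have "N <#> K = N <#> (S \<inter> (N <#> K))" if K: "K \<subseteq> carrier G" for K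
  proof
    show "N <#> K \<subseteq> N <#> (S \<inter> (N <#> K))"
    proof
      fix x assume x: "x \<in> N <#> K"
      then have xc: "x \<in> carrier G"
        using setmult_subset_G[OF subgroup.subset[OF assms(1)] K] by auto
      then obtain n where n: "n \<in> N" "n \<otimes> x \<in> S"
        using S mem_set_mult_subgroup_iff[OF assms(1) S(2)] by blast
      have "n \<otimes> x \<in> N <#> (N <#> K)"
        using n(1) x unfolding set_mult_def by blast
      also have "\<dots> = N <#> K"
        using set_mult_assoc[of N N K] K subgroup.subset[OF assms(1)]
          subgroup_mult_id[OF assms(1)] by simp
      finally show "x \<in> N <#> (S \<inter> (N <#> K))"
        using n mem_set_mult_subgroup_iff[OF assms(1) _ xc, of "S \<inter> (N <#> K)"] S(2) by auto
    qed
    have "N <#> (S \<inter> (N <#> K)) \<subseteq> N <#> (N <#> K)"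
      by (rule mono_set_mult) auto
    also have "\<dots> = N <#> K"
      using set_mult_assoc[of N N K] K subgroup.subset[OF assms(1)]
        subgroup_mult_id[OF assms(1)] by simp
    finally show "N <#> (S \<inter> (N <#> K)) \<subseteq> N <#> K" .
  qed
  then have "N <#> K \<in> (\<lambda>K. N <#> K) ` Pow S" if "K \<subseteq> carrier G" for K
    using that by (intro image_eqI[of _ _ "S \<inter> (N <#> K)"]) simp_all
  then have "(\<lambda>K. N <#> K) ` Pow (carrier G) \<subseteq> (\<lambda>K. N <#> K) ` Pow S"
    by (intro image_subsetI) simp
  then show ?thesis
    by (rule finite_subset) (simp add: S(1))
qed

end

section \<open>The conjugation action on closed subgroups\<close>

context topological_group
begin

sublocale conj: group_action G "closed_subgroups G T" "conjugation G T"
  by (rule group_action_conjugation)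

lemma conjugation_eq:
  "H \<in> closed_subgroups G T \<Longrightarrow> conjugation G T g H = g <# H #> inv g"
  by (simp add: conjugation_def)

text \<open>Normality of \<open>N\<close> makes conjugation compatible with passing to
  \<open>G/N\<close>. Hence one \<open>N\<close> serves for \<open>H\<close> and all its conjugates
  at once.\<close>

lemma conjugation_set_mult:
  assumes N: "N \<in> open_normal_subgroups G T" and H: "H \<in> closed_subgroups G T" and g: "g \<in> carrier G"
  shows "conjugation G T g (N <#> H) = N <#> conjugation G T g H"
proof -
  note N' = open_normal_subgroupD[OF N] and H' = closed_subgroupD[OF H]
  have Nc: "N \<subseteq> carrier G" using N'(2) by (rule subgroup.subset)
  have "N <#> conjugation G T g H = N <#> (g <# H) #> inv g"
    using setmult_rcos_assoc[OF Nc l_coset_subset_G[OF H'(3) g], of "inv g"] g H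
    by (simp add: conjugation_eq)
  also have "N <#> (g <# H) = g <# (N <#> H)"
    using rcos_assoc_lcos[OF Nc H'(3) g] setmult_lcos_assoc[OF Nc H'(3) g]
      normal.coset_eq[OF N'(1)] g by metis
  finally show ?thesis
    using conjugation_eq[OF set_mult_closed_subgroup(3)[OF N H'(1)]] by simp
qed

lemma conjugation_nhd:
  assumes N: "N \<in> open_normal_subgroups G T" and H: "H \<in> closed_subgroups G T"
    and g: "g \<in> carrier G" and K: "K \<in> subgroup_nhd G T N H"
  shows "conjugation G T g K \<in> subgroup_nhd G T N (conjugation G T g H)"
proof -
  have K': "K \<in> closed_subgroups G T" "N <#> K = N <#> H"
    using K by (auto simp: subgroup_nhd_def)
  then have "N <#> conjugation G T g K = N <#> conjugation G T g H"
    using conjugation_set_mult[OF N _ g] H by metis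
  then show ?thesis
    using conj.element_image[OF g K'(1) refl] by (simp add: subgroup_nhd_def)
qed

lemma orbit_eq_iff:
  assumes "H \<in> closed_subgroups G T" "K \<in> closed_subgroups G T"
  shows "orbit G (conjugation G T) H = orbit G (conjugation G T) K \<longleftrightarrow>
    (\<exists>g\<in>carrier G. K = conjugation G T g H)"
proof
  assume "orbit G (conjugation G T) H = orbit G (conjugation G T) K"
  then have "K \<in> orbit G (conjugation G T) H"
    using conj.orbit_refl[OF assms(2)] by simp
  then show "\<exists>g\<in>carrier G. K = conjugation G T g H"
    by (auto simp: orbit_def)
next
  assume "\<exists>g\<in>carrier G. K = conjugation G T g H"
  then have K: "K \<in> orbit G (conjugation G T) H"
    by (auto simp: orbit_def)
  have H: "H \<in> orbit G (conjugation G T) K"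
    by (rule conj.orbit_sym[OF assms K])
  have in_E: "L \<in> closed_subgroups G T" if "L \<in> orbit G (conjugation G T) M"
    "M \<in> closed_subgroups G T" for L M
    using that conj.element_image by (auto simp: orbit_def)
  show "orbit G (conjugation G T) H = orbit G (conjugation G T) K"
    using conj.orbit_trans[OF assms(1,2) in_E[OF _ assms(2)] K]
      conj.orbit_trans[OF assms(2,1) in_E[OF _ assms(1)] H] by auto
qed

text \<open>Saturations of open sets are open: if a conjugate of \<open>H\<close> lies in
  \<open>U\<close> together with its neighbourhood for \<open>N\<close>, conjugating by the same
  element carries the neighbourhood of \<open>H\<close> for \<open>N\<close> into
  \<open>U\<close>.\<close>

lemma open_map_orbit:
  "open_map (Sub_topology G T) (Sub_mod_conj G T) (orbit G (conjugation G T))"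
  unfolding open_map_def
proof (intro allI impI)
  let ?p = "orbit G (conjugation G T)" and ?E = "closed_subgroups G T"
  fix U assume U: "openin (Sub_topology G T) U"
  then have UE: "U \<subseteq> ?E"
    by (simp add: openin_Sub_topology)
  have "openin (Sub_topology G T) {H \<in> ?E. ?p H \<in> ?p ` U}"
    unfolding openin_Sub_topology
  proof (intro conjI ballI)
    fix H assume H: "H \<in> {H \<in> ?E. ?p H \<in> ?p ` U}"
    then obtain K where K: "K \<in> U" "?p H = ?p K" by auto
    then obtain g where g: "g \<in> carrier G" "K = conjugation G T g H"
      using orbit_eq_iff[of H K] H UE by auto
    obtain N where N: "N \<in> open_normal_subgroups G T" "subgroup_nhd G T N K \<subseteq> U"
      using U K(1) unfolding openin_Sub_topology by auto
    have "L \<in> {H \<in> ?E. ?p H \<in> ?p ` U}" if L: "L \<in> subgroup_nhd G T N H" for L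
    proof -
      have L': "L \<in> ?E" using L by (simp add: subgroup_nhd_def)
      have cU: "conjugation G T g L \<in> U"
        using conjugation_nhd[OF N(1) _ g(1) L] H N(2) g(2) by auto
      then have "?p L = ?p (conjugation G T g L)"
        using orbit_eq_iff[OF L'] UE g(1) by auto
      then show ?thesis using cU L' by simp
    qed
    then show "\<exists>N\<in>open_normal_subgroups G T. subgroup_nhd G T N H \<subseteq> {H \<in> ?E. ?p H \<in> ?p ` U}"
      using N(1) by (intro bexI[of _ N] subsetI)
  qed auto
  then show "openin (Sub_mod_conj G T) (?p ` U)"
    using UE by (simp add: Sub_mod_conj_def openin_quotient_topology topspace_Sub_topology image_mono)
qed

lemma quotient_map_orbit:
  "quotient_map (Sub_topology G T) (Sub_mod_conj G T) (orbit G (conjugation G T))"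
  unfolding Sub_mod_conj_def by (rule quotient_map_quotient_topology)

end

section \<open>Compactness and the Hausdorff property\<close>

context profinite_group
begin

lemma Hausdorff_space_Sub: "Hausdorff_space (Sub_topology G T)"
  unfolding Hausdorff_space_def topspace_Sub_topology
proof (intro allI impI, elim conjE)
  fix H K assume HK: "H \<in> closed_subgroups G T" "K \<in> closed_subgroups G T" "H \<noteq> K"
  have "(\<Inter>N\<in>open_normal_subgroups G T. N <#> H) \<noteq> (\<Inter>N\<in>open_normal_subgroups G T. N <#> K)"
    using HK by (simp add: Inter_set_mult_closed_subgroup)
  then obtain N where N: "N \<in> open_normal_subgroups G T" "N <#> H \<noteq> N <#> K"
    by (meson INF_cong)
  then have "disjnt (subgroup_nhd G T N H) (subgroup_nhd G T N K)"
    by (auto simp: subgroup_nhd_def disjnt_iff)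
  then show "\<exists>U V. openin (Sub_topology G T) U \<and> openin (Sub_topology G T) V \<and>
      H \<in> U \<and> K \<in> V \<and> disjnt U V"
    using openin_subgroup_nhd[OF N(1), of H] openin_subgroup_nhd[OF N(1), of K] HK
    by (intro exI[of _ "subgroup_nhd G T N H"] exI[of _ "subgroup_nhd G T N K"])
      (simp add: subgroup_nhd_def)
qed

text \<open>The orbit is the image of the compact group \<open>G\<close> under the continuous map
  sending \<open>g\<close> to the conjugate of \<open>H\<close> by \<open>g\<close>.\<close>

lemma closedin_orbit:
  assumes H: "H \<in> closed_subgroups G T"
  shows "closedin (Sub_topology G T) (orbit G (conjugation G T) H)"
proof -
  have "continuous_map T (Sub_topology G T) (\<lambda>g. conjugation G T g H)"
    unfolding continuous_map_def
  proof (intro conjI allI impI)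
    show "(\<lambda>g. conjugation G T g H) \<in> topspace T \<rightarrow> topspace (Sub_topology G T)"
      using conj.element_image H by (auto simp: topspace_Sub_topology topspace_eq_carrier)
    fix U assume U: "openin (Sub_topology G T) U"
    show "openin T {g \<in> topspace T. conjugation G T g H \<in> U}"
    proof (subst openin_subopen, intro ballI)
      fix g assume "g \<in> {g \<in> topspace T. conjugation G T g H \<in> U}"
      then have g: "g \<in> carrier G" "conjugation G T g H \<in> U"
        by (auto simp: topspace_eq_carrier)
      let ?K = "conjugation G T g H"
      obtain N where N: "N \<in> open_normal_subgroups G T" "subgroup_nhd G T N ?K \<subseteq> U"
        using U g(2) unfolding openin_Sub_topology by auto
      note N' = open_normal_subgroupD[OF N(1)]
      have K: "?K \<in> closed_subgroups G T"
        using conj.element_image[OF g(1) H refl] .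
      have "conjugation G T (n \<otimes> g) H \<in> U" if n: "n \<in> N" for n
      proof -
        have nc: "n \<in> carrier G" using n N'(2) by (simp add: subgroup.mem_carrier)
        note NK = set_mult_closed_subgroup[OF N(1) closed_subgroupD(1)[OF K]]
        have nNK: "n \<in> N <#> ?K"
          using subset_set_mult(1)[OF N'(2) closed_subgroupD(1)[OF K]] n by auto
        have "N <#> conjugation G T n ?K = n <# (N <#> ?K) #> inv n"
          using conjugation_set_mult[OF N(1) K nc] conjugation_eq[OF NK(3)] by simp
        \<comment> \<open>Here \<open>n\<close> lies in the subgroup \<open>N <#> ?K\<close>, and a
          subgroup is fixed under conjugation by its own elements.\<close>
        also have "\<dots> = N <#> ?K"
          using nNK NK(1) by (simp add: coset_join2 coset_join3 subgroup.m_inv_closed nc)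
        finally have "conjugation G T n ?K \<in> subgroup_nhd G T N ?K"
          using conj.element_image[OF nc K refl] by (simp add: subgroup_nhd_def)
        then show ?thesis
          using N(2) conj.composition_rule[OF H nc g(1)] by auto
      qed
      moreover have "N #> g \<subseteq> topspace T"
        using r_coset_subset_G[OF subgroup.subset[OF N'(2)] g(1)] topspace_eq_carrier by simp
      ultimately have "N #> g \<subseteq> {g \<in> topspace T. conjugation G T g H \<in> U}"
        by (auto simp: r_coset_def)
      moreover have "g \<in> N #> g" "openin T (N #> g)"
        using rcos_self[OF g(1) N'(2)] openin_r_coset[OF N'(3) g(1)] by auto
      ultimately show "\<exists>V. openin T V \<and> g \<in> V \<and> V \<subseteq> {g \<in> topspace T. conjugation G T g H \<in> U}"
        by (intro exI[of _ "N #> g"] conjI)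
    qed
  qed
  then have "compactin (Sub_topology G T) ((\<lambda>g. conjugation G T g H) ` topspace T)"
    using compact image_compactin unfolding compact_space_def by metis
  moreover have "(\<lambda>g. conjugation G T g H) ` topspace T = orbit G (conjugation G T) H"
    by (auto simp: orbit_def topspace_eq_carrier)
  ultimately show ?thesis
    using compactin_imp_closedin[OF Hausdorff_space_Sub] by simp
qed

text \<open>Choose \<open>N\<close> so that the neighbourhood of \<open>K\<close> misses the closed
  orbit of \<open>H\<close>. If some \<open>L\<close> near \<open>H\<close> had a conjugate near
  \<open>K\<close>, the same conjugation would move \<open>H\<close> itself into the neighbourhood
  of \<open>K\<close>. So the two neighbourhoods for this \<open>N\<close> have disjoint, open
  images.\<close>

lemma Hausdorff_space_Sub_mod_conj: "Hausdorff_space (Sub_mod_conj G T)"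
  unfolding Hausdorff_space_def
proof (intro allI impI, elim conjE)
  let ?p = "orbit G (conjugation G T)" and ?E = "closed_subgroups G T"
  fix x y assume xy: "x \<in> topspace (Sub_mod_conj G T)" "y \<in> topspace (Sub_mod_conj G T)" "x \<noteq> y"
  then obtain H K where HK: "H \<in> ?E" "x = ?p H" "K \<in> ?E" "y = ?p K"
    unfolding topspace_Sub_mod_conj orbits_def by auto
  have "K \<notin> ?p H"
    using xy(3) HK orbit_eq_iff[OF HK(1,3)] by (auto simp: orbit_def)
  then have "K \<in> ?E - ?p H" using HK by simp
  moreover have "openin (Sub_topology G T) (?E - ?p H)"
    using closedin_orbit[OF HK(1)] by (simp add: closedin_def topspace_Sub_topology)
  ultimately obtain N where N: "N \<in> open_normal_subgroups G T" "subgroup_nhd G T N K \<subseteq> ?E - ?p H"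
    unfolding openin_Sub_topology by auto
  let ?U = "?p ` subgroup_nhd G T N H" and ?V = "?p ` subgroup_nhd G T N K"
  have "?p L \<noteq> ?p M" if L: "L \<in> subgroup_nhd G T N H" and M: "M \<in> subgroup_nhd G T N K" for L M
  proof
    assume "?p L = ?p M"
    then obtain g where g: "g \<in> carrier G" "M = conjugation G T g L"
      using orbit_eq_iff[of L M] L M by (auto simp: subgroup_nhd_def)
    have "M \<in> subgroup_nhd G T N (conjugation G T g H)"
      using conjugation_nhd[OF N(1) HK(1) g(1) L] g(2) by simp
    then have "conjugation G T g H \<in> subgroup_nhd G T N K"
      using M conj.element_image[OF g(1) HK(1) refl] by (auto simp: subgroup_nhd_def)
    then show False
      using N(2) g(1) by (auto simp: orbit_def)
  qed
  then have "disjnt ?U ?V"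
    by (auto simp: disjnt_iff)
  moreover have "openin (Sub_mod_conj G T) ?U" "openin (Sub_mod_conj G T) ?V"
    using open_map_orbit openin_subgroup_nhd[OF N(1)] unfolding open_map_def by simp_all
  moreover have "x \<in> ?U" "y \<in> ?V"
    using HK by (auto simp: subgroup_nhd_def)
  ultimately show "\<exists>U V. openin (Sub_mod_conj G T) U \<and> openin (Sub_mod_conj G T) V \<and>
      x \<in> U \<and> y \<in> V \<and> disjnt U V"
    by (intro exI[of _ ?U] exI[of _ ?V] conjI)
qed

lemma finite_set_mult_closed_subgroups:
  assumes "N \<in> open_normal_subgroups G T"
  shows "finite ((\<lambda>K. N <#> K) ` closed_subgroups G T)"
proof (rule finite_subset)
  show "(\<lambda>K. N <#> K) ` closed_subgroups G T \<subseteq> (\<lambda>K. N <#> K) ` Pow (carrier G)"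
    using closed_subgroupD(3) by (intro image_mono) blast
  show "finite ((\<lambda>K. N <#> K) ` Pow (carrier G))"
    using finite_set_mult_image open_normal_subgroupD[OF assms] by simp
qed

text \<open>This is surjectivity onto the inverse limit of the \<open>Sub(G/N)\<close>, with
  \<open>f N\<close> the preimage in \<open>G\<close> of a subgroup of \<open>G/N\<close>.
  Compactness enters in \<open>f N \<subseteq> N <#> ?H\<close>: for \<open>x\<close> in
  \<open>f N\<close>, the closed sets \<open>f M \<inter> (N #> x)\<close> are directed and
  nonempty, and a common point lies in \<open>?H\<close> and in the coset of
  \<open>x\<close>.\<close>

lemma Inter_compatible_family:
  assumes f: "\<And>N. N \<in> open_normal_subgroups G T \<Longrightarrow> f N \<in> (\<lambda>K. N <#> K) ` closed_subgroups G T"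
    and compatible: "\<And>M N. M \<in> open_normal_subgroups G T \<Longrightarrow> N \<in> open_normal_subgroups G T \<Longrightarrow>
      M \<subseteq> N \<Longrightarrow> N <#> f M = f N"
  shows "\<Inter>(f ` open_normal_subgroups G T) \<in> closed_subgroups G T" (is "?H \<in> _")
    and "\<And>N. N \<in> open_normal_subgroups G T \<Longrightarrow> N <#> \<Inter>(f ` open_normal_subgroups G T) = f N"
proof -
  let ?I = "open_normal_subgroups G T"
  have I: "?I \<noteq> {}" using carrier_in_open_normal_subgroups by auto
  have fE: "f N \<in> closed_subgroups G T" if "N \<in> ?I" for N
    using f[OF that] set_mult_closed_subgroup(3)[OF that] closed_subgroupD(1) by auto
  show H: "?H \<in> closed_subgroups G T"
    unfolding closed_subgroups_def
  proof (intro CollectI conjI)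
    show "subgroup ?H G"
      using I fE closed_subgroupD(1) by (intro subgroups_Inter) auto
    show "closedin T ?H"
      using I fE closed_subgroupD(2) by (intro closedin_Inter) auto
  qed
  fix N assume N: "N \<in> ?I"
  note N' = open_normal_subgroupD[OF N]
  show "N <#> ?H = f N"
  proof
    have "N <#> ?H \<subseteq> N <#> f N"
      using N by (intro mono_set_mult) auto
    then show "N <#> ?H \<subseteq> f N"
      using compatible[OF N N] by simp
    show "f N \<subseteq> N <#> ?H"
    proof
      fix x assume x: "x \<in> f N"
      then have xc: "x \<in> carrier G"
        using closed_subgroupD(3)[OF fE[OF N]] by auto
      have "\<Inter>((\<lambda>M. f M \<inter> (N #> x)) ` ?I) \<noteq> {}"
      proof (rule compact_directed_Inter_nonempty[OF compact I])
        fix M assume M: "M \<in> ?I"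
        have "closedin T (N #> x)"
          using closedin_set_mult[OF N'(2,3), of "{x}"] xc by (simp add: r_coset_eq_set_mult)
        then show "closedin T (f M \<inter> (N #> x))"
          using closed_subgroupD(2)[OF fE[OF M]] by (simp add: closedin_Int)
        have MN: "M \<inter> N \<in> ?I"
          using Int_in_open_normal_subgroups[OF M N] .
        note fMN = closed_subgroupD[OF fE[OF MN]]
        have "x \<in> N <#> f (M \<inter> N)"
          using x compatible[OF MN N] by simp
        then obtain n where n: "n \<in> N" "n \<otimes> x \<in> f (M \<inter> N)"
          using mem_set_mult_subgroup_iff[OF N'(2) fMN(3) xc] by auto
        have "f (M \<inter> N) \<subseteq> f M"
          using subset_set_mult(2)[OF open_normal_subgroupD(2)[OF M] fMN(1)]
            compatible[OF MN M] by simp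
        then show "f M \<inter> (N #> x) \<noteq> {}"
          using n by (auto simp: r_coset_def)
      next
        fix L M assume LM: "L \<in> ?I" "M \<in> ?I"
        have LM': "L \<inter> M \<in> ?I"
          using Int_in_open_normal_subgroups[OF LM] .
        note fLM = closed_subgroupD[OF fE[OF LM']]
        have "f (L \<inter> M) \<subseteq> f L \<inter> f M"
          using subset_set_mult(2)[OF open_normal_subgroupD(2)[OF LM(1)] fLM(1)]
            subset_set_mult(2)[OF open_normal_subgroupD(2)[OF LM(2)] fLM(1)]
            compatible[OF LM' LM(1)] compatible[OF LM' LM(2)] by simp
        then show "\<exists>K\<in>?I. f K \<inter> (N #> x) \<subseteq> (f L \<inter> (N #> x)) \<inter> (f M \<inter> (N #> x))"
          using LM' by (intro bexI[of _ "L \<inter> M"]) auto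
      qed
      then obtain y where "y \<in> ?H" "y \<in> N #> x"
        using I by auto
      then show "x \<in> N <#> ?H"
        using mem_set_mult_subgroup_iff[OF N'(2) closed_subgroupD(3)[OF H] xc]
        by (auto simp: r_coset_def)
    qed
  qed
qed

text \<open>
  The compatible families form a closed subset of a product of finite discrete spaces, and taking
  intersections maps it continuously onto the space of closed subgroups.
\<close>

lemma compact_space_Sub: "compact_space (Sub_topology G T)"
proof -
  let ?I = "open_normal_subgroups G T" and ?E = "closed_subgroups G T"
  define Y where "Y N = (\<lambda>K. N <#> K) ` ?E" for N
  define P where "P = product_topology (\<lambda>N. discrete_topology (Y N)) ?I"
  have topP: "topspace P = PiE ?I Y"
    by (simp add: P_def)
  have compP: "compact_space P"
    using finite_set_mult_closed_subgroups
    by (simp add: P_def compact_space_product_topology compact_space_discrete_topology Y_def)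
  have cont: "continuous_map P (discrete_topology (Y N)) (\<lambda>f. f N)" if "N \<in> ?I" for N
    unfolding P_def using that by (rule continuous_map_product_projection)
  have YE: "Y N \<subseteq> ?E" if "N \<in> ?I" for N
    using set_mult_closed_subgroup(3)[OF that] closed_subgroupD(1) by (auto simp: Y_def)
  \<comment> \<open>An equalizer of two continuous maps into a discrete space, hence closed;
    intersecting over all \<open>M \<subseteq> N\<close> gives the inverse limit
    \<open>Z\<close>.\<close>
  define C where "C M N = {f \<in> topspace P. N <#> f M = f N}" for M N
  have closedC: "closedin P (C M N)" if "M \<in> ?I" "N \<in> ?I" for M N
  proof -
    have "(\<lambda>K. N <#> K) \<in> Y M \<rightarrow> Y N"
      using YE[OF that(1)] by (auto simp: Y_def)
    then have "continuous_map (discrete_topology (Y M)) (discrete_topology (Y N)) (\<lambda>K. N <#> K)"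
      by simp
    from continuous_map_compose[OF cont[OF that(1)] this]
    have "continuous_map P (discrete_topology (Y N)) (\<lambda>f. N <#> f M)"
      by (simp add: o_def)
    then show ?thesis
      unfolding C_def using cont[OF that(2)]
      by (intro closedin_continuous_maps_eq[of "discrete_topology (Y N)"]) auto
  qed
  define Z where "Z = \<Inter>((\<lambda>(M, N). C M N) ` {(M, N). M \<in> ?I \<and> N \<in> ?I \<and> M \<subseteq> N})"
  have "carrier G \<in> ?I" by (rule carrier_in_open_normal_subgroups)
  then have "closedin P Z"
    unfolding Z_def using closedC by (intro closedin_Inter) auto
  then have compZ: "compactin P Z" and ZP: "Z \<subseteq> topspace P"
    using closedin_compact_space[OF compP] closedin_subset by auto
  have topZ: "topspace (subtopology P Z) = Z"
    using ZP by (rule topspace_subtopology_subset)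
  let ?\<phi> = "\<lambda>f. \<Inter>(f ` ?I)"
  have ZY: "f N \<in> (\<lambda>K. N <#> K) ` ?E" if "f \<in> Z" "N \<in> ?I" for f N
    using subsetD[OF ZP that(1)] that(2) by (auto simp: topP Y_def PiE_iff)
  have ZC: "N <#> f M = f N" if "f \<in> Z" "M \<in> ?I" "N \<in> ?I" "M \<subseteq> N" for f M N
    using that unfolding Z_def C_def by auto
  have \<phi>: "?\<phi> f \<in> ?E" "N \<in> ?I \<Longrightarrow> N <#> ?\<phi> f = f N" if "f \<in> Z" for f N
    using Inter_compatible_family[of f] ZY[OF that] ZC[OF that] by auto
  have "continuous_map (subtopology P Z) (Sub_topology G T) ?\<phi>"
    unfolding continuous_map_def topZ topspace_Sub_topology
  proof (intro conjI allI impI)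
    show "?\<phi> \<in> Z \<rightarrow> ?E" using \<phi>(1) by auto
    fix U assume U: "openin (Sub_topology G T) U"
    show "openin (subtopology P Z) {f \<in> Z. ?\<phi> f \<in> U}"
    proof (subst openin_subopen, intro ballI)
      fix f assume "f \<in> {f \<in> Z. ?\<phi> f \<in> U}"
      then have f: "f \<in> Z" "?\<phi> f \<in> U" by auto
      then obtain N where N: "N \<in> ?I" "subgroup_nhd G T N (?\<phi> f) \<subseteq> U"
        using U unfolding openin_Sub_topology by auto
      \<comment> \<open>Fixing the single coordinate \<open>N\<close> is an open condition, and that
        coordinate already determines \<open>N <#> ?\<phi> h\<close>.\<close>
      let ?V = "{h \<in> topspace (subtopology P Z). h N \<in> {f N}}"
      have "openin (discrete_topology (Y N)) {f N}"
        using ZY[OF f(1) N(1)] by (simp add: Y_def)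
      then have "openin (subtopology P Z) ?V"
        by (rule openin_continuous_map_preimage[OF continuous_map_from_subtopology[OF cont[OF N(1)]]])
      moreover have "f \<in> ?V" using f(1) topZ by simp
      moreover have "?V \<subseteq> {f \<in> Z. ?\<phi> f \<in> U}"
      proof
        fix h assume "h \<in> ?V"
        then have h: "h \<in> Z" "h N = f N" using topZ by auto
        then have "?\<phi> h \<in> subgroup_nhd G T N (?\<phi> f)"
          using \<phi>[OF h(1)] \<phi>[OF f(1)] N(1) by (simp add: subgroup_nhd_def)
        then show "h \<in> {f \<in> Z. ?\<phi> f \<in> U}" using N(2) h(1) by auto
      qed
      ultimately show "\<exists>V. openin (subtopology P Z) V \<and> f \<in> V \<and> V \<subseteq> {f \<in> Z. ?\<phi> f \<in> U}"
        by (intro exI[of _ ?V] conjI)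
    qed
  qed
  moreover have "compactin (subtopology P Z) Z"
    using compZ by (simp add: compactin_subtopology)
  ultimately have "compactin (Sub_topology G T) (?\<phi> ` Z)"
    by (rule image_compactin[rotated])
  moreover have "?\<phi> ` Z = ?E"
  proof
    show "?\<phi> ` Z \<subseteq> ?E" using \<phi>(1) by auto
    show "?E \<subseteq> ?\<phi> ` Z"
    proof
      fix H assume H: "H \<in> ?E"
      define f where "f = (\<lambda>N\<in>?I. N <#> H)"
      have "N <#> (M <#> H) = N <#> H" if "M \<in> ?I" "N \<in> ?I" "M \<subseteq> N" for M N
      proof -
        note MN = open_normal_subgroupD[OF that(1)] open_normal_subgroupD[OF that(2)]
        have "M <#> H \<in> subgroup_nhd G T M H"
          using set_mult_closed_subgroup(3,4)[OF that(1) closed_subgroupD(1)[OF H]]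
          by (simp add: subgroup_nhd_def)
        then show ?thesis
          using subgroup_nhd_mono[OF MN(1,4) that(3) H] by (auto simp: subgroup_nhd_def)
      qed
      then have "f \<in> Z"
        unfolding Z_def C_def topP f_def using H by (auto simp: Y_def)
      moreover have "?\<phi> f = H"
        using Inter_set_mult_closed_subgroup[OF H] by (simp add: f_def)
      ultimately show "H \<in> ?\<phi> ` Z" by blast
    qed
  qed
  ultimately show ?thesis
    by (simp add: compact_space_def topspace_Sub_topology)
qed

lemma compact_space_Sub_mod_conj: "compact_space (Sub_mod_conj G T)"
  using compact_space_Sub quotient_imp_continuous_map[OF quotient_map_orbit]
    quotient_imp_surjective_map[OF quotient_map_orbit] image_compactin
  unfolding compact_space_def by metis

section \<open>Second countability\<close>

text \<open>
  For an open subgroup \<open>K\<close> near \<open>H\<close> and a proper open subgroup \<open>M\<close> supplementing a small \<open>N\<close>,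
  the subgroup \<open>K \<inter> M\<close> is again near \<open>H\<close>, but it is not conjugate to \<open>K\<close> since it omits part of \<open>N\<close>.
\<close>

lemma isolated_orbit_imp_no_open_supplement:
  assumes H: "H \<in> closed_subgroups G T"
    and isolated: "openin (Sub_mod_conj G T) {orbit G (conjugation G T) H}"
  obtains N where "N \<in> open_normal_subgroups G T"
    "\<And>M. subgroup M G \<Longrightarrow> openin T M \<Longrightarrow> N <#> M = carrier G \<Longrightarrow> M = carrier G"
proof -
  let ?p = "orbit G (conjugation G T)" and ?E = "closed_subgroups G T"
  have "openin (Sub_topology G T) {K \<in> ?E. ?p K \<in> {?p H}}"
    using isolated by (simp add: Sub_mod_conj_def openin_quotient_topology topspace_Sub_topology)
  then obtain L where L: "L \<in> open_normal_subgroups G T"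
    and nhd: "subgroup_nhd G T L H \<subseteq> {K \<in> ?E. ?p K \<in> {?p H}}"
    unfolding openin_Sub_topology using H by auto
  let ?K = "L <#> H"
  note K = set_mult_closed_subgroup[OF L closed_subgroupD(1)[OF H]]
  have K_nhd: "?K \<in> subgroup_nhd G T L H"
    using K(3,4) by (simp add: subgroup_nhd_def)
  obtain C where C: "C \<in> open_normal_subgroups G T" "C \<subseteq> ?K"
    using nhd_contains_open_normal_subgroup[OF K(2) subgroup.one_closed[OF K(1)]] .
  \<comment> \<open>The two factors have separate roles: \<open>L\<close> keeps
    \<open>?K \<inter> M\<close> in the isolating neighbourhood, while \<open>C\<close>, being
    normal and inside \<open>?K\<close>, lies in every conjugate of \<open>?K\<close>.\<close>
  let ?N = "L \<inter> C"
  have N: "?N \<in> open_normal_subgroups G T"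
    using Int_in_open_normal_subgroups[OF L C(1)] .
  note N' = open_normal_subgroupD[OF N]
  have "M = carrier G" if M: "subgroup M G" "openin T M" "?N <#> M = carrier G" for M
  proof -
    let ?K' = "?K \<inter> M"
    have sub: "subgroup ?K' G"
      using subgroups_Inter_pair[OF K(1) M(1)] .
    have K'E: "?K' \<in> ?E"
      using open_subgroup_imp_closed[OF sub] K(2) M(2) by (simp add: openin_Int)
    have NK: "?N <#> ?K = ?K"
      by (rule set_mult_absorb[OF K(1) le_infI2[OF C(2)] subgroup.one_closed[OF N'(2)]])
    \<comment> \<open>Dedekind's modular law: as \<open>?N \<subseteq> ?K\<close>, the product of
      \<open>?N\<close> with \<open>?K \<inter> M\<close> is
      \<open>?K \<inter> (?N <#> M)\<close>.\<close>
    have "?N <#> ?K' = ?K"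
    proof
      have "?N <#> ?K' \<subseteq> ?N <#> ?K" by (rule mono_set_mult) auto
      then show "?N <#> ?K' \<subseteq> ?K" using NK by simp
      show "?K \<subseteq> ?N <#> ?K'"
      proof
        fix x assume x: "x \<in> ?K"
        then have xc: "x \<in> carrier G" using subgroup.mem_carrier[OF K(1)] by simp
        then obtain n where n: "n \<in> ?N" "n \<otimes> x \<in> M"
          using mem_set_mult_subgroup_iff[OF N'(2) subgroup.subset[OF M(1)] xc] M(3) by auto
        then have "n \<otimes> x \<in> ?K'"
          using x C(2) subgroup.m_closed[OF K(1)] by auto
        then show "x \<in> ?N <#> ?K'"
          using mem_set_mult_subgroup_iff[OF N'(2) subgroup.subset[OF sub] xc] n(1) by auto
      qed
    qed
    then have "?K' \<in> subgroup_nhd G T ?N ?K"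
      using K'E NK by (simp add: subgroup_nhd_def)
    then have "?K' \<in> subgroup_nhd G T L ?K"
      using subgroup_nhd_mono[OF N'(1) open_normal_subgroupD(1)[OF L] _ K(3)] by auto
    then have "?K' \<in> subgroup_nhd G T L H"
      using K(4) by (simp add: subgroup_nhd_def)
    then have "?p ?K = ?p ?K'"
      using K_nhd nhd by auto
    then obtain g where g: "g \<in> carrier G" "?K' = conjugation G T g ?K"
      using orbit_eq_iff[OF K(3) K'E] by auto
    have "C <#> ?K = ?K"
      by (rule set_mult_absorb[OF K(1) C(2) subgroup.one_closed[OF open_normal_subgroupD(2)[OF C(1)]]])
    then have "C <#> ?K' = ?K'"
      using conjugation_set_mult[OF C(1) K(3) g(1)] g(2) by simp
    then have "C \<subseteq> ?K'"
      using subset_set_mult(1)[OF open_normal_subgroupD(2)[OF C(1)] sub] by simp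
    then have "?N \<subseteq> M" by auto
    then have "?N <#> M = M"
      by (rule set_mult_absorb[OF M(1) _ subgroup.one_closed[OF N'(2)]])
    then show ?thesis using M(3) by simp
  qed
  with N show thesis by (rule that)
qed

text \<open>
  An open normal subgroup \<open>U\<close> is recorded by the multiplication (in fact division) table of \<open>G/U\<close>,
  with its elements labelled by natural numbers, and by the labels of a finite set \<open>S\<close> that
  generates \<open>G\<close> topologically.
\<close>

lemma countable_open_normal_subgroups:
  assumes N: "N \<in> open_normal_subgroups G T"
    and no_supplement:
      "\<And>M. subgroup M G \<Longrightarrow> openin T M \<Longrightarrow> N <#> M = carrier G \<Longrightarrow> M = carrier G"
  shows "countable (open_normal_subgroups G T)"
proof -
  let ?I = "open_normal_subgroups G T"
  note N' = open_normal_subgroupD[OF N]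
  obtain S where S: "finite S" "S \<subseteq> carrier G" "N <#> S = carrier G"
    using finite_transversal[OF N'(2,3)] .
  have S_ne: "S \<noteq> {}"
  proof
    assume "S = {}"
    then have "carrier G = {}" using S(3) by (simp add: set_mult_def)
    then show False by auto
  qed
  \<comment> \<open>Labelling cosets by natural numbers puts the tables of all quotients into one
    countable set of codes.\<close>
  have "\<exists>l :: 'a \<Rightarrow> nat. finite (l ` carrier G) \<and>
      (\<forall>x\<in>carrier G. \<forall>y\<in>carrier G. l x = l y \<longleftrightarrow> U #> x = U #> y)" if U: "U \<in> ?I" for U
  proof -
    have "(\<lambda>x. U #> x) ` carrier G \<subseteq> (\<lambda>K. U <#> K) ` Pow (carrier G)"
      by (auto simp: r_coset_eq_set_mult)
    then have "finite ((\<lambda>x. U #> x) ` carrier G)"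
      by (rule finite_subset[OF _ finite_set_mult_image[OF open_normal_subgroupD(2,3)[OF U]]])
    then obtain e :: "'a set \<Rightarrow> nat" where e: "inj_on e ((\<lambda>x. U #> x) ` carrier G)"
      and fin: "finite ((\<lambda>x. U #> x) ` carrier G)"
      using finite_imp_inj_to_nat_seg by metis
    have "finite ((\<lambda>x. e (U #> x)) ` carrier G)"
      using finite_imageI[OF fin, of e] by (simp add: image_image)
    then show ?thesis
      using e by (intro exI[of _ "\<lambda>x. e (U #> x)"]) (simp add: inj_on_eq_iff)
  qed
  then obtain l :: "'a set \<Rightarrow> 'a \<Rightarrow> nat" where l_fin: "finite (l U ` carrier G)"
    and l_iff: "x \<in> carrier G \<Longrightarrow> y \<in> carrier G \<Longrightarrow> l U x = l U y \<longleftrightarrow> U #> x = U #> y"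
    if "U \<in> ?I" for U x y
    by metis
  define R where "R U = (\<lambda>(x, y). (l U x, l U y, l U (x \<otimes> inv y))) ` (carrier G \<times> carrier G)" for U
  define d where "d U = (R U, (\<lambda>s. (s, l U s)) ` S)" for U
  have l_div: "l U (x \<otimes> inv y) = l U (x' \<otimes> inv y')"
    if U: "U \<in> ?I" and c: "x \<in> carrier G" "y \<in> carrier G" "x' \<in> carrier G" "y' \<in> carrier G"
      and eq: "l U x = l U x'" "l U y = l U y'" for U x y x' y'
  proof -
    interpret U: normal U G using open_normal_subgroupD(1)[OF U] .
    have "U #> x = U #> x'" "U #> inv y = U #> inv y'"
      using l_iff[OF U] c eq U.rcos_inv[of y] U.rcos_inv[of y'] by auto
    then have "U #> (x \<otimes> inv y) = U #> (x' \<otimes> inv y')"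
      using U.rcos_sum[of x "inv y"] U.rcos_sum[of x' "inv y'"] c by simp
    then show ?thesis using l_iff[OF U] c by simp
  qed
  have "inj_on d ?I"
  proof (rule inj_onI)
    fix U V assume U: "U \<in> ?I" and V: "V \<in> ?I" and eq: "d U = d V"
    note U' = open_normal_subgroupD[OF U] and V' = open_normal_subgroupD[OF V]
    \<comment> \<open>The set where the two labellings agree. Equal division tables make it a
      subgroup, it contains \<open>S\<close> so that \<open>N <#> K\<close> is everything, and it
      contains \<open>U \<inter> V\<close> so that it is open; \<open>no_supplement\<close> then
      gives \<open>K = carrier G\<close>.\<close>
    define K where "K = {x \<in> carrier G. l U x = l V x}"
    have K_div: "x \<otimes> inv y \<in> K" if "x \<in> K" "y \<in> K" for x y
    proof -
      have xy: "x \<in> carrier G" "y \<in> carrier G" "l U x = l V x" "l U y = l V y"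
        using that by (auto simp: K_def)
      have "(l U x, l U y, l U (x \<otimes> inv y)) \<in> R U"
        unfolding R_def by (rule image_eqI[of _ _ "(x, y)"]) (simp_all add: xy(1,2))
      then have "(l U x, l U y, l U (x \<otimes> inv y)) \<in> R V"
        using eq by (simp add: d_def)
      \<comment> \<open>Equality of the tables yields only some \<open>x'\<close>, \<open>y'\<close>
        with the right labels under \<open>V\<close>; \<open>l_div\<close> says that the label of a
        quotient depends on labels alone, so \<open>x\<close>, \<open>y\<close> may replace
        them.\<close>
      then obtain x' y' where xy': "x' \<in> carrier G" "y' \<in> carrier G" "l V x' = l U x"
        "l V y' = l U y" "l V (x' \<otimes> inv y') = l U (x \<otimes> inv y)"
        by (auto simp: R_def)
      have "l V (x' \<otimes> inv y') = l V (x \<otimes> inv y)"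
        by (rule l_div[OF V xy'(1,2) xy(1,2)]) (simp_all add: xy(3,4) xy'(3,4))
      then show ?thesis using xy(1,2) xy'(5) by (simp add: K_def)
    qed
    have SK: "S \<subseteq> K"
    proof
      fix s assume s: "s \<in> S"
      then have "(s, l U s) \<in> (\<lambda>s. (s, l V s)) ` S"
        using eq by (auto simp: d_def)
      then show "s \<in> K" using s S(2) by (auto simp: K_def)
    qed
    have one: "\<one> \<in> K"
    proof -
      obtain s where s: "s \<in> S" using S_ne by auto
      then have "s \<in> carrier G" "s \<in> K" using SK S(2) by auto
      then show ?thesis using K_div[of s s] by simp
    qed
    have Kc: "K \<subseteq> carrier G" by (auto simp: K_def)
    have K_inv: "inv x \<in> K" if "x \<in> K" for x
      using K_div[OF one that] subsetD[OF Kc that] by simp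
    have sub: "subgroup K G"
    proof (rule subgroupI)
      show "x \<otimes> y \<in> K" if "x \<in> K" "y \<in> K" for x y
        using K_div[OF that(1) K_inv[OF that(2)]] subsetD[OF Kc that(2)] by simp
    qed (use Kc one K_inv in auto)
    have mem: "x \<in> W \<longleftrightarrow> l W x = l W \<one>" if "W \<in> ?I" "x \<in> carrier G" for W x
    proof -
      have W: "subgroup W G" using open_normal_subgroupD(2)[OF that(1)] .
      have "x \<in> W \<longleftrightarrow> W #> x = W"
        using coset_join1[OF _ that(2) W] coset_join2[OF that(2) W] by auto
      then show ?thesis
        using l_iff[OF that(1,2), of \<one>] coset_mult_one[OF subgroup.subset[OF W]] by simp
    qed
    \<comment> \<open>On \<open>U \<inter> V\<close> each labelling takes its value at
      \<open>\<one>\<close>, and these two values agree because \<open>\<one>\<close> is in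
      \<open>K\<close>.\<close>
    have "U \<inter> V \<subseteq> K"
    proof
      fix x assume x: "x \<in> U \<inter> V"
      then have xc: "x \<in> carrier G" using U'(2) subgroup.mem_carrier by auto
      then show "x \<in> K"
        using x mem[OF U] mem[OF V] one by (auto simp: K_def)
    qed
    then have "openin T K"
      using openin_subgroup_superset[OF sub] open_normal_subgroupD[OF Int_in_open_normal_subgroups[OF U V]]
      by simp
    moreover have "N <#> K = carrier G"
      using S(3) mono_set_mult[OF subset_refl SK, of G N]
        setmult_subset_G[OF subgroup.subset[OF N'(2)] Kc] by auto
    ultimately have "K = carrier G"
      using no_supplement[OF sub] by simp
    then have "l U x = l V x" if "x \<in> carrier G" for x
      using that by (auto simp: K_def)
    then have "x \<in> U \<longleftrightarrow> x \<in> V" if "x \<in> carrier G" for x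
      using mem[OF U that] mem[OF V that] that by simp
    then show "U = V"
      using subgroup.subset[OF U'(2)] subgroup.subset[OF V'(2)] by auto
  qed
  moreover have "countable (d ` ?I)"
  proof (rule countable_subset)
    have "finite (R U)" if "U \<in> ?I" for U
    proof (rule finite_subset)
      show "R U \<subseteq> l U ` carrier G \<times> l U ` carrier G \<times> l U ` carrier G"
        by (auto simp: R_def)
    qed (use l_fin[OF that] in simp)
    then show "d ` ?I \<subseteq> {A. finite A \<and> A \<subseteq> UNIV} \<times> {A. finite A \<and> A \<subseteq> S \<times> UNIV}"
      using S(1) by (auto simp: d_def)
    show "countable ({A :: (nat \<times> nat \<times> nat) set. finite A \<and> A \<subseteq> UNIV} \<times>
        {A :: ('a \<times> nat) set. finite A \<and> A \<subseteq> S \<times> UNIV})"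
      using S(1) by (intro countable_SIGMA countable_Collect_finite_subset) (auto intro: countable_finite)
  qed
  ultimately show ?thesis
    by (rule countable_image_inj_on[rotated])
qed

section \<open>Countable bases of \<open>Sub(G)\<close> and of its quotient\<close>

lemma second_countable_Sub:
  assumes "countable (open_normal_subgroups G T)"
  shows "second_countable (Sub_topology G T)"
proof -
  let ?I = "open_normal_subgroups G T" and ?E = "closed_subgroups G T"
  \<comment> \<open>Indexing by the value \<open>A\<close> of \<open>N <#> K\<close> instead of by
    \<open>H\<close> shows that each \<open>N\<close> contributes only finitely many basic
    sets.\<close>
  define \<B> where "\<B> = (\<Union>N\<in>?I. (\<lambda>A. {K \<in> ?E. N <#> K = A}) ` (\<lambda>K. N <#> K) ` ?E)"
  have "countable \<B>"
    unfolding \<B>_def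
    by (intro countable_UN[OF assms] countable_image countable_finite[OF finite_set_mult_closed_subgroups])
  moreover have \<B>: "\<B> = (\<Union>N\<in>?I. subgroup_nhd G T N ` ?E)"
    unfolding \<B>_def image_image subgroup_nhd_def ..
  have "openin (Sub_topology G T) V" if "V \<in> \<B>" for V
    using that openin_subgroup_nhd unfolding \<B> by auto
  moreover have "\<exists>V\<in>\<B>. H \<in> V \<and> V \<subseteq> U" if UH: "openin (Sub_topology G T) U" "H \<in> U" for U H
  proof -
    obtain N where N: "N \<in> ?I" "subgroup_nhd G T N H \<subseteq> U" and H: "H \<in> ?E"
      using UH unfolding openin_Sub_topology by blast
    have "H \<in> subgroup_nhd G T N H"
      using H by (simp add: subgroup_nhd_def)
    moreover have "subgroup_nhd G T N H \<in> \<B>"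
      unfolding \<B> using N(1) H by (auto intro: UN_I)
    ultimately show ?thesis using N(2) by blast
  qed
  ultimately show ?thesis
    unfolding second_countable_def by (intro exI[of _ \<B>]) simp
qed

text \<open>Scatteredness enters through one isolated orbit of the whole space. The countable base
  of \<open>Sub(G)\<close> passes to the quotient because the orbit map is open, continuous and
  surjective.\<close>

lemma scattered_imp_second_countable:
  assumes "scattered_space (Sub_mod_conj G T)"
  shows "second_countable (Sub_mod_conj G T)"
proof -
  let ?X = "Sub_mod_conj G T"
  have "carrier G \<in> closed_subgroups G T"
    using open_subgroup_imp_closed open_normal_subgroupD carrier_in_open_normal_subgroups by auto
  then have "topspace ?X \<noteq> {}"
    by (auto simp: topspace_Sub_mod_conj orbits_def)
  then obtain x where "x \<in> topspace ?X" "openin ?X {x}"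
    using assms closedin_topspace[of ?X] unfolding scattered_space_def
    by (metis subtopology_topspace)
  then obtain H where "H \<in> closed_subgroups G T" "openin ?X {orbit G (conjugation G T) H}"
    by (auto simp: topspace_Sub_mod_conj orbits_def)
  then have "countable (open_normal_subgroups G T)"
    using isolated_orbit_imp_no_open_supplement countable_open_normal_subgroups by metis
  then show ?thesis
    using second_countable_open_map_image[OF quotient_imp_continuous_map[OF quotient_map_orbit]
        open_map_orbit quotient_imp_surjective_map[OF quotient_map_orbit] second_countable_Sub]
    by simp
qed

end

theorem theorem12p4:
  fixes G (structure) and T :: "'a topology"
  assumes "profinite_group G T"
  shows "scattered_space (Sub_mod_conj G T) \<longleftrightarrow> countable (topspace (Sub_mod_conj G T))"
proof -
  interpret profinite_group G T by (rule assms)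
  show ?thesis
    using scattered_imp_countable scattered_imp_second_countable
      compact_Hausdorff_countable_imp_scattered[OF compact_space_Sub_mod_conj
        Hausdorff_space_Sub_mod_conj] by auto
qed

end
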